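(* Let $X$ be a Banach space and let $S=(X;X_k,k\geqslant 1)$ be a system of closed linear subspaces of $X$ which is a representing system of subspaces in $X$. Define $X_k'=\bigcap_{j\neq k}X_j^{\bot}\subset X^*$, $k\geqslant 1$. Then the system of subspaces $X_k'$, $k\geqslant 1$, is a Schauder decomposition of the closure (in $X^*$) of its linear span.
   Context: $X$ is a Banach space over $\mathbb{K}$ ($=\mathbb{R}$ or $\mathbb{C}$), $X^*$ is its dual. "Subspace" means closed linear subset. A system $S=(X;X_k,k\geqslant 1)$ of subspaces of $X$ is a representing system of subspaces in $X$ if every $x\in X$ can be written as a norm-convergent series $x=\sum_{k=1}^\infty x_k$ with $x_k\in X_k$, $k\geqslant 1$. For $M\subset X$, $M^{\bot}=\{\varphi\in X^*: \varphi(x)=0 \text{ for all } x\in M\}$. A system of subspaces $G_k$, $k\geqslant 1$, of a Banach space $E$ is called a Schauder decomposition of $E$ if for every $x\in E$ there exist unique $x_k\in G_k$, $k\geqslant 1$, such that $x=\sum_{k=1}^\infty x_k$ (norm convergence). The subspaces $G_k$ are allowed to be zero. *)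

theory Defs
  imports "HOL-Analysis.Analysis"
begin

text \<open>
  The scalar field is a type of sort \<open>{real_normed_field, euclidean_space}\<close>: a commutative field
  that is a finite-dimensional real algebra with multiplicative norm, hence, up to isometric
  isomorphism, the reals or the complex numbers; the types \<open>real\<close> and \<open>complex\<close> are both
  instances. The norm and topology of the space are those of its type. The
  last axiom says that the real scalar multiplication built into that type is the restriction
  of \<open>smul\<close>.
\<close>

locale normed_space_over = vector_space smul
  for smul :: "'k::{real_normed_field,euclidean_space} \<Rightarrow> 'a::real_normed_vector \<Rightarrow> 'a" +
  assumes norm_scale: "norm (smul c x) = norm c * norm x"
    and scale_of_real: "smul (of_real r) x = r *\<^sub>R x"

definition closed_subspace ::
  "('k::{real_normed_field,euclidean_space} \<Rightarrow> 'a::real_normed_vector \<Rightarrow> 'a) \<Rightarrow> 'a set \<Rightarrow> bool"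
  where "closed_subspace smul M \<longleftrightarrow> module.subspace smul M \<and> closed M"

text \<open>Systems of subspaces are indexed from 0 instead of 1, so that \<open>sums\<close> applies directly.\<close>

definition representing_system ::
  "('k::{real_normed_field,euclidean_space} \<Rightarrow> 'a::real_normed_vector \<Rightarrow> 'a) \<Rightarrow> (nat \<Rightarrow> 'a set) \<Rightarrow> bool"
  where "representing_system smul X \<longleftrightarrow>
    (\<forall>k. closed_subspace smul (X k)) \<and>
    (\<forall>x. \<exists>xs. (\<forall>k. xs k \<in> X k) \<and> xs sums x)"

definition schauder_decomposition ::
  "('k::{real_normed_field,euclidean_space} \<Rightarrow> 'a::banach \<Rightarrow> 'a) \<Rightarrow> 'a set \<Rightarrow> (nat \<Rightarrow> 'a set) \<Rightarrow> bool"
  where "schauder_decomposition smul E G \<longleftrightarrow>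
    closed_subspace smul E \<and>
    (\<forall>k. closed_subspace smul (G k) \<and> G k \<subseteq> E) \<and>
    (\<forall>x\<in>E. \<exists>!xs. (\<forall>k. xs k \<in> G k) \<and> xs sums x)"

text \<open>
  The type \<open>'a \<Rightarrow>\<^sub>L 'k\<close> consists of the bounded real-linear maps with the operator norm. The dual
  is its closed subset of scalar-linear maps (lemma \<open>closed_subspace_dual\<close>), with the
  induced norm; in particular closures taken in the type and in the dual agree.
\<close>

definition dual_space ::
  "('k::{real_normed_field,euclidean_space} \<Rightarrow> 'a::real_normed_vector \<Rightarrow> 'a) \<Rightarrow> ('a \<Rightarrow>\<^sub>L 'k) set"
  where "dual_space smul = {\<phi>. \<forall>c x. blinfun_apply \<phi> (smul c x) = c * blinfun_apply \<phi> x}"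

definition dual_scale ::
  "'k::{real_normed_field,euclidean_space} \<Rightarrow> ('a::real_normed_vector \<Rightarrow>\<^sub>L 'k) \<Rightarrow> ('a \<Rightarrow>\<^sub>L 'k)"
  where "dual_scale c \<phi> = blinfun_mult_right c o\<^sub>L \<phi>"

definition annihilator ::
  "('k::{real_normed_field,euclidean_space} \<Rightarrow> 'a::real_normed_vector \<Rightarrow> 'a) \<Rightarrow> 'a set \<Rightarrow> ('a \<Rightarrow>\<^sub>L 'k) set"
  where "annihilator smul M = {\<phi> \<in> dual_space smul. \<forall>x\<in>M. blinfun_apply \<phi> x = 0}"

definition dual_system ::
  "('k::{real_normed_field,euclidean_space} \<Rightarrow> 'a::real_normed_vector \<Rightarrow> 'a) \<Rightarrow> (nat \<Rightarrow> 'a set) \<Rightarrow>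
    nat \<Rightarrow> ('a \<Rightarrow>\<^sub>L 'k) set"
  where "dual_system smul X k = (\<Inter>j\<in>{j. j \<noteq> k}. annihilator smul (X j))"

lemma dual_scale_apply [simp]: "blinfun_apply (dual_scale c \<phi>) x = c * blinfun_apply \<phi> x"
  by (simp add: dual_scale_def)

lemma normed_space_over_scaleR: "normed_space_over ((*\<^sub>R) :: real \<Rightarrow> 'a::real_normed_vector \<Rightarrow> 'a)"
  by unfold_locales (auto simp: algebra_simps)

lemma normed_space_over_complex: "normed_space_over ((*) :: complex \<Rightarrow> complex \<Rightarrow> complex)"
  by unfold_locales (auto simp: algebra_simps norm_mult scaleR_conv_of_real)

lemma normed_space_over_dual_scale:
  "normed_space_over (dual_scale ::
    'k::{real_normed_field,euclidean_space} \<Rightarrow> ('a::real_normed_vector \<Rightarrow>\<^sub>L 'k) \<Rightarrow> _)"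
proof
  fix c :: 'k and \<phi> :: "'a \<Rightarrow>\<^sub>L 'k"
  have le: "norm (dual_scale d \<psi>) \<le> norm d * norm \<psi>" for d :: 'k and \<psi> :: "'a \<Rightarrow>\<^sub>L 'k"
    by (rule norm_blinfun_bound)
      (auto simp: norm_mult mult.assoc intro!: mult_left_mono norm_blinfun)
  show "norm (dual_scale c \<phi>) = norm c * norm \<phi>"
  proof (cases "c = 0")
    case True
    then show ?thesis using le[of c \<phi>] by simp
  next
    case False
    have "dual_scale (inverse c) (dual_scale c \<phi>) = \<phi>"
      using False by (intro blinfun_eqI) (simp add: mult.assoc[symmetric])
    then have "norm \<phi> \<le> inverse (norm c) * norm (dual_scale c \<phi>)"
      using le[of "inverse c" "dual_scale c \<phi>"] False by (simp add: norm_inverse)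
    then show ?thesis using le[of c \<phi>] False by (simp add: field_simps)
  qed
qed (auto intro!: blinfun_eqI simp: blinfun.bilinear_simps algebra_simps scaleR_conv_of_real)

lemma closed_subspace_dual:
  fixes smul :: "'k::{real_normed_field,euclidean_space} \<Rightarrow> 'a::real_normed_vector \<Rightarrow> 'a"
  shows "closed_subspace dual_scale (dual_space smul)"
proof -
  interpret D: normed_space_over "dual_scale :: 'k \<Rightarrow> ('a \<Rightarrow>\<^sub>L 'k) \<Rightarrow> _"
    by (rule normed_space_over_dual_scale)
  have "closed (dual_space smul)"
    unfolding dual_space_def
    by (intro closed_Collect_all closed_Collect_eq continuous_intros)
  then show ?thesis
    unfolding closed_subspace_def D.subspace_def
    by (auto simp: dual_space_def blinfun.bilinear_simps algebra_simps)
qed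

end

theory Submission
  imports Defs
begin

text \<open>
  The dual system satisfies a Grunblum condition: there is a constant \<open>C\<close> such that
  \<open>\<parallel>\<phi>\<^sub>0 + \<dots> + \<phi>\<^sub>m\<parallel> \<le> C \<parallel>\<phi>\<^sub>0 + \<dots> + \<phi>\<^sub>n\<parallel>\<close> for \<open>m \<le> n\<close> and \<open>\<phi>\<^sub>k\<close> in the \<open>k\<close>-th space, and any
  sequence of closed subspaces with this property is a Schauder decomposition of its closed span
  (lemma \<open>schauder_decomposition_if_partial_sums_bounded\<close>).

  For the condition, expand a vector as \<open>x = \<Sum>x\<^sub>k\<close> along the representing system. As \<open>\<phi>\<^sub>k\<close> vanishes
  on all \<open>X\<^sub>j\<close> with \<open>j \<noteq> k\<close>, the value of \<open>\<phi>\<^sub>0 + \<dots> + \<phi>\<^sub>m\<close> at \<open>x\<close> is the value of the longer sum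
  \<open>\<phi>\<^sub>0 + \<dots> + \<phi>\<^sub>n\<close> at the partial sum \<open>x\<^sub>0 + \<dots> + x\<^sub>m\<close> (lemma \<open>dual_system_partial_sum_apply\<close>). The
  partial sums of a convergent series are bounded, so the inequality holds pointwise, with a constant
  depending on \<open>x\<close> but not on \<open>m\<close>, \<open>n\<close> or the \<open>\<phi>\<^sub>k\<close>; the uniform boundedness principle makes the
  constant independent of \<open>x\<close>. The
  expansion of \<open>x\<close> need not be unique, nor chosen with partial sums controlled by \<open>\<parallel>x\<parallel>\<close>.
\<close>

section \<open>Uniform boundedness\<close>

text \<open>
  The uniform boundedness principle relative to weights \<open>r i\<close>. Weights that may vanish spare the
  normalisation of the functionals to which the lemma is applied.
\<close>

lemma uniform_boundedness_weighted:
  fixes f :: "'i \<Rightarrow> 'a::banach \<Rightarrow>\<^sub>L 'b::real_normed_vector" and r :: "'i \<Rightarrow> real"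
  assumes r: "\<And>i. i \<in> I \<Longrightarrow> 0 \<le> r i"
    and bounded: "\<And>x. \<exists>B. \<forall>i\<in>I. norm (f i x) \<le> B * r i"
  shows "\<exists>C\<ge>0. \<forall>i\<in>I. norm (f i) \<le> C * r i"
proof -
  define F where "F n = {x. \<forall>i\<in>I. norm (f i x) \<le> real n * r i}" for n
  have closed: "closed (F n)" for n
  proof -
    have "F n = (\<Inter>i\<in>I. {x. norm (f i x) \<le> real n * r i})"
      by (auto simp: F_def)
    then show ?thesis
      by (auto intro!: closed_INT closed_Collect_le continuous_intros)
  qed
  have "x \<in> (\<Union>n. F n)" for x
  proof -
    obtain B where B: "\<forall>i\<in>I. norm (f i x) \<le> B * r i"
      using bounded by blast
    obtain n where "B \<le> real n"
      using real_arch_simple by blast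
    then have "x \<in> F n"
      unfolding F_def using B r by (blast intro: order_trans mult_right_mono)
    then show ?thesis by blast
  qed
  then have cover: "\<Union>(range F) = UNIV" by blast
  (* Baire: the countable closed cover has a member with interior points. *)
  have "\<exists>n. interior (F n) \<noteq> {}"
  proof (rule ccontr)
    assume "\<not> ?thesis"
    then have "euclidean interior_of (\<Union>(range F)) = {}"
      using closed completely_metrizable_space_euclidean
      by (intro Baire_category_alt) auto
    then show False
      by (simp add: cover)
  qed
  then obtain n a where "a \<in> interior (F n)" by blast
  then obtain e where e: "e > 0" "cball a e \<subseteq> F n"
    by (meson mem_interior_cball)
  have "norm (f i) \<le> (2 * real n / e) * r i" if i: "i \<in> I" for i
  proof (rule norm_blinfun_bound)
    show "0 \<le> 2 * real n / e * r i"
      using e r[OF i] by simp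
    fix x :: 'a
    show "norm (f i x) \<le> 2 * real n / e * r i * norm x"
    proof (cases "x = 0")
      case True
      then show ?thesis by simp
    next
      case False
      define t where "t = e / norm x"
      have t: "t > 0" using False e by (simp add: t_def)
      have "a + t *\<^sub>R x \<in> cball a e" "a \<in> cball a e"
        using e False by (auto simp: t_def dist_norm)
      then have "a + t *\<^sub>R x \<in> F n" "a \<in> F n"
        using e by blast+
      then have "norm (f i (a + t *\<^sub>R x)) \<le> real n * r i" "norm (f i a) \<le> real n * r i"
        using i by (auto simp: F_def)
      moreover have "t * norm (f i x) = norm (f i (a + t *\<^sub>R x) - f i a)"
        using t by (simp add: blinfun.bilinear_simps)
      ultimately have "t * norm (f i x) \<le> 2 * (real n * r i)"
        using norm_triangle_ineq4[of "f i (a + t *\<^sub>R x)" "f i a"] by linarith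
      then show ?thesis
        using e False by (simp add: t_def field_simps)
    qed
  qed
  then show ?thesis
    using e by (intro exI[of _ "2 * real n / e"]) auto
qed

section \<open>Grunblum condition and Schauder decompositions\<close>

lemma (in normed_space_over) bounded_linear_smul: "bounded_linear (smul c)"
proof (rule bounded_linear_intro)
  fix x y and r :: real
  show "smul c (x + y) = smul c x + smul c y"
    by (rule scale_right_distrib)
  show "smul c (r *\<^sub>R x) = r *\<^sub>R smul c x"
    using scale_left_commute[of c "of_real r" x] by (simp only: scale_of_real)
  show "norm (smul c x) \<le> norm x * norm c"
    by (simp add: norm_scale mult.commute)
qed

text \<open>
  The vectors that have an expansion along \<open>G\<close> form a closed set: by the bound on partial sums,
  expansions of a convergent sequence of vectors converge coordinatewise, uniformly for all partial
  sums.
\<close>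

lemma closed_sums_of_subspaces:
  fixes smul :: "'k::{real_normed_field,euclidean_space} \<Rightarrow> 'a::banach \<Rightarrow> 'a"
  assumes "normed_space_over smul"
    and G: "\<And>k. closed_subspace smul (G k)"
    and "C \<ge> 0"
    and bound: "\<And>xs m n. \<lbrakk>\<And>k. xs k \<in> G k; m \<le> n\<rbrakk> \<Longrightarrow>
      norm (\<Sum>k<m. xs k) \<le> C * norm (\<Sum>k<n. xs k)"
  shows "closed {x. \<exists>xs. (\<forall>k. xs k \<in> G k) \<and> xs sums x}"
proof (unfold closed_sequential_limits, intro allI impI, elim conjE)
  interpret normed_space_over smul by fact
  have sub: "subspace (G k)" and clo: "closed (G k)" for k
    using G by (auto simp: closed_subspace_def)
  have bound_lim: "norm (\<Sum>k<m. xs k) \<le> C * norm x"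
    if "\<And>k. xs k \<in> G k" "xs sums x" for xs x m
  proof (rule tendsto_lowerbound)
    show "((\<lambda>n. C * norm (\<Sum>k<n. xs k)) \<longlongrightarrow> C * norm x) sequentially"
      using that(2) unfolding sums_def by (intro tendsto_intros)
    show "\<forall>\<^sub>F n in sequentially. norm (\<Sum>k<m. xs k) \<le> C * norm (\<Sum>k<n. xs k)"
      using eventually_ge_at_top[of m] by eventually_elim (rule bound[OF that(1)])
  qed simp
  fix u :: "nat \<Rightarrow> 'a" and x
  assume "\<forall>i. u i \<in> {x. \<exists>xs. (\<forall>k. xs k \<in> G k) \<and> xs sums x}" and u: "u \<longlonglongrightarrow> x"
  then obtain y where y: "\<And>i k. y i k \<in> G k" "\<And>i. y i sums u i"
    by simp metis
  have S: "norm ((\<Sum>k<m. y i k) - (\<Sum>k<m. y j k)) \<le> C * norm (u i - u j)" for m i j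
    using bound_lim[of "\<lambda>k. y i k - y j k" "u i - u j" m] y
    by (simp add: sum_subtractf sums_diff subspace_diff sub)
  have "\<exists>z. (\<lambda>i. y i k) \<longlonglongrightarrow> z" for k
  proof -
    have *: "norm (y i k - y j k) \<le> 2 * C * norm (u i - u j)" for i j
      using S[where m = "Suc k" and i = i and j = j] S[where m = k and i = i and j = j]
        norm_triangle_ineq4[of "(\<Sum>l<Suc k. y i l) - (\<Sum>l<Suc k. y j l)"
          "(\<Sum>l<k. y i l) - (\<Sum>l<k. y j l)"]
      by (simp add: algebra_simps)
    have "Cauchy (\<lambda>i. y i k)"
    proof (rule CauchyI)
      fix e :: real assume "e > 0"
      then have "e / (2 * C + 1) > 0" using \<open>C \<ge> 0\<close> by simp
      then obtain M where M: "\<And>i j. i \<ge> M \<Longrightarrow> j \<ge> M \<Longrightarrow> norm (u i - u j) < e / (2 * C + 1)"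
        using CauchyD[OF LIMSEQ_imp_Cauchy[OF u]] by blast
      have "norm (y i k - y j k) < e" if "i \<ge> M" "j \<ge> M" for i j
      proof -
        have "norm (y i k - y j k) \<le> (2 * C + 1) * norm (u i - u j)"
          using *[of i j] by (simp add: algebra_simps add_increasing)
        also have "\<dots> < e"
          using M[OF that] \<open>C \<ge> 0\<close> by (simp add: field_simps)
        finally show ?thesis .
      qed
      then show "\<exists>M. \<forall>i\<ge>M. \<forall>j\<ge>M. norm (y i k - y j k) < e" by blast
    qed
    then show ?thesis
      by (simp add: Cauchy_convergent_iff convergent_def)
  qed
  then obtain z where z: "\<And>k. (\<lambda>i. y i k) \<longlonglongrightarrow> z k" by metis
  have zG: "z k \<in> G k" for k
    using closed_sequentially[OF clo _ z] y by blast
  have Sz: "norm ((\<Sum>k<m. y i k) - (\<Sum>k<m. z k)) \<le> C * norm (u i - x)" for m i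
  proof (rule tendsto_le)
    show "(\<lambda>j. norm ((\<Sum>k<m. y i k) - (\<Sum>k<m. y j k))) \<longlonglongrightarrow>
        norm ((\<Sum>k<m. y i k) - (\<Sum>k<m. z k))"
      by (intro tendsto_intros z)
    show "(\<lambda>j. C * norm (u i - u j)) \<longlonglongrightarrow> C * norm (u i - x)"
      by (intro tendsto_intros u)
  qed (auto simp: S)
  have "z sums x"
    unfolding sums_def
  proof (rule LIMSEQ_I)
    fix e :: real assume "e > 0"
    then have "e / (2 * (C + 1)) > 0" using \<open>C \<ge> 0\<close> by simp
    then obtain i where i: "norm (u i - x) < e / (2 * (C + 1))"
      using LIMSEQ_D[OF u] by blast
    obtain N where N: "\<And>m. m \<ge> N \<Longrightarrow> norm ((\<Sum>k<m. y i k) - u i) < e / 2"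
      using LIMSEQ_D[OF y(2)[unfolded sums_def], of "e / 2" i] \<open>e > 0\<close> by auto
    have "norm ((\<Sum>k<m. z k) - x) < e" if "m \<ge> N" for m
    proof -
      have "(\<Sum>k<m. z k) - x =
          ((\<Sum>k<m. y i k) - u i) + (u i - x) - ((\<Sum>k<m. y i k) - (\<Sum>k<m. z k))"
        by simp
      then have "norm ((\<Sum>k<m. z k) - x) \<le>
          norm ((\<Sum>k<m. y i k) - u i) + norm (u i - x) + C * norm (u i - x)"
        using Sz[where m = m and i = i] by (smt (verit) norm_triangle_ineq norm_triangle_ineq4)
      moreover have "norm (u i - x) + C * norm (u i - x) < e / 2"
        using i \<open>C \<ge> 0\<close> by (simp add: field_simps)
      ultimately show ?thesis
        using N[OF that] by linarith
    qed
    then show "\<exists>N. \<forall>m\<ge>N. norm ((\<Sum>k<m. z k) - x) < e" by blast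
  qed
  then show "x \<in> {x. \<exists>xs. (\<forall>k. xs k \<in> G k) \<and> xs sums x}"
    using zG by blast
qed

text \<open>
  The sufficiency half of the Grunblum criterion. The vectors with an expansion along \<open>G\<close> are
  exactly the closed span, and letting \<open>n\<close> tend to infinity in the bound for an expansion of zero
  makes all its partial sums vanish.
\<close>

lemma schauder_decomposition_if_partial_sums_bounded:
  fixes smul :: "'k::{real_normed_field,euclidean_space} \<Rightarrow> 'a::banach \<Rightarrow> 'a"
  assumes "normed_space_over smul"
    and G: "\<And>k. closed_subspace smul (G k)"
    and "C \<ge> 0"
    and bound: "\<And>xs m n. \<lbrakk>\<And>k. xs k \<in> G k; m \<le> n\<rbrakk> \<Longrightarrow>
      norm (\<Sum>k<m. xs k) \<le> C * norm (\<Sum>k<n. xs k)"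
  shows "schauder_decomposition smul (closure (module.span smul (\<Union>k. G k))) G"
proof -
  interpret normed_space_over smul by fact
  have sub: "subspace (G k)" for k
    using G by (auto simp: closed_subspace_def)
  define D where "D = {x. \<exists>xs. (\<forall>k. xs k \<in> G k) \<and> xs sums x}"
  have DI: "x \<in> D" if "(\<forall>k. xs k \<in> G k) \<and> xs sums x" for xs x
    unfolding D_def using that by (intro CollectI exI[of _ xs])
  have closedD: "closed D"
    unfolding D_def by (rule closed_sums_of_subspaces[OF assms])
  have subD: "subspace D"
  proof (rule subspaceI)
    show "0 \<in> D"
      by (rule DI[of "\<lambda>_. 0"]) (simp add: subspace_0 sub)
  next
    fix x y assume "x \<in> D" "y \<in> D"
    then obtain xs ys where "\<And>k. xs k \<in> G k" "xs sums x" "\<And>k. ys k \<in> G k" "ys sums y"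
      unfolding D_def by blast
    then have "(\<forall>k. xs k + ys k \<in> G k) \<and> (\<lambda>k. xs k + ys k) sums (x + y)"
      by (simp add: sums_add subspace_add sub)
    then show "x + y \<in> D"
      by (rule DI)
  next
    fix c x assume "x \<in> D"
    then obtain xs where "\<And>k. xs k \<in> G k" "xs sums x"
      unfolding D_def by blast
    then have "(\<forall>k. smul c (xs k) \<in> G k) \<and> (\<lambda>k. smul c (xs k)) sums smul c x"
      by (simp add: bounded_linear.sums[OF bounded_linear_smul] subspace_scale sub)
    then show "smul c x \<in> D"
      by (rule DI)
  qed
  have GD: "G k \<subseteq> D" for k
  proof
    fix x assume "x \<in> G k"
    then have "(\<forall>j. (if j = k then x else 0) \<in> G j) \<and> (\<lambda>j. if j = k then x else 0) sums x"
      using sums_single[of k "\<lambda>_. x"] by (simp add: subspace_0 sub)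
    then show "x \<in> D"
      by (rule DI)
  qed
  have "D \<subseteq> closure (span (\<Union>k. G k))"
  proof
    fix x assume "x \<in> D"
    then obtain xs where xs: "\<And>k. xs k \<in> G k" "(\<lambda>n. \<Sum>k<n. xs k) \<longlonglongrightarrow> x"
      unfolding D_def sums_def by blast
    have "(\<Sum>k<n. xs k) \<in> span (\<Union>k. G k)" for n
      using xs(1) by (intro span_sum span_base) blast
    then show "x \<in> closure (span (\<Union>k. G k))"
      unfolding closure_sequential using xs(2)
      by (intro exI[of _ "\<lambda>n. \<Sum>k<n. xs k"]) simp
  qed
  moreover have "span (\<Union>k. G k) \<subseteq> D"
    using GD by (intro span_minimal subD) blast
  ultimately have closure_eq: "closure (span (\<Union>k. G k)) = D"
    using closedD by (meson closure_minimal subset_antisym)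
  have unique: "xs = ys"
    if "\<And>k. xs k \<in> G k" "\<And>k. ys k \<in> G k" "xs sums x" "ys sums x" for xs ys x
  proof -
    define d where "d k = xs k - ys k" for k
    have dG: "d k \<in> G k" for k
      using that(1,2) by (simp add: d_def subspace_diff sub)
    have d0: "(\<lambda>n. \<Sum>k<n. d k) \<longlonglongrightarrow> 0"
      using sums_diff[OF that(3,4)] by (simp add: d_def sums_def)
    have zero: "(\<Sum>k<m. d k) = 0" for m
    proof -
      have "norm (\<Sum>k<m. d k) \<le> C * norm (0 :: 'a)"
      proof (rule tendsto_lowerbound)
        show "((\<lambda>n. C * norm (\<Sum>k<n. d k)) \<longlongrightarrow> C * norm (0 :: 'a)) sequentially"
          by (intro tendsto_intros d0)
        show "\<forall>\<^sub>F n in sequentially. norm (\<Sum>k<m. d k) \<le> C * norm (\<Sum>k<n. d k)"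
          using eventually_ge_at_top[of m] by eventually_elim (rule bound[OF dG])
      qed simp
      then show ?thesis by simp
    qed
    have "d k = 0" for k
      using zero[of "Suc k"] zero[of k] by simp
    then show ?thesis by (auto simp: d_def)
  qed
  show ?thesis
    unfolding schauder_decomposition_def closure_eq
  proof (intro conjI allI ballI G GD)
    show "closed_subspace smul D"
      using subD closedD by (simp add: closed_subspace_def)
    fix x assume "x \<in> D"
    then show "\<exists>!xs. (\<forall>k. xs k \<in> G k) \<and> xs sums x"
      unfolding D_def using unique by blast
  qed
qed

section \<open>The dual system of a representing system\<close>

lemma closed_subspace_dual_system:
  fixes smul :: "'k::{real_normed_field,euclidean_space} \<Rightarrow> 'a::real_normed_vector \<Rightarrow> 'a"
  shows "closed_subspace dual_scale (dual_system smul X k)"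
proof -
  interpret D: normed_space_over "dual_scale :: 'k \<Rightarrow> ('a \<Rightarrow>\<^sub>L 'k) \<Rightarrow> _"
    by (rule normed_space_over_dual_scale)
  have "closed_subspace dual_scale (annihilator smul M)" for M
  proof -
    have "annihilator smul M = dual_space smul \<inter> {\<phi>. \<forall>x. x \<in> M \<longrightarrow> blinfun_apply \<phi> x = 0}"
      by (auto simp: annihilator_def)
    moreover have "closed {\<phi> :: 'a \<Rightarrow>\<^sub>L 'k. \<forall>x. x \<in> M \<longrightarrow> blinfun_apply \<phi> x = 0}"
      by (intro closed_Collect_all closed_Collect_imp closed_Collect_eq continuous_intros) simp
    moreover have "D.subspace {\<phi> :: 'a \<Rightarrow>\<^sub>L 'k. \<forall>x. x \<in> M \<longrightarrow> blinfun_apply \<phi> x = 0}"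
      by (auto simp: D.subspace_def blinfun.bilinear_simps)
    ultimately show ?thesis
      using closed_subspace_dual[of smul]
      by (simp add: closed_subspace_def closed_Int D.subspace_inter)
  qed
  then show ?thesis
    unfolding closed_subspace_def dual_system_def
    by (auto intro!: closed_INT D.subspace_Int)
qed

lemma dual_system_partial_sum_apply:
  fixes smul :: "'k::{real_normed_field,euclidean_space} \<Rightarrow> 'a::real_normed_vector \<Rightarrow> 'a"
  assumes \<phi>: "\<And>k. \<phi> k \<in> dual_system smul X k"
    and xs: "\<And>k. xs k \<in> X k" "xs sums x"
    and "m \<le> n"
  shows "blinfun_apply (\<Sum>k<m. \<phi> k) x = blinfun_apply (\<Sum>k<n. \<phi> k) (\<Sum>j<m. xs j)"
proof -
  have zero: "blinfun_apply (\<phi> k) (xs j) = 0" if "j \<noteq> k" for j k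
    using \<phi>[of k] xs(1)[of j] that by (auto simp: dual_system_def annihilator_def)
  have diag: "blinfun_apply (\<phi> k) x = blinfun_apply (\<phi> k) (xs k)" for k
  proof (rule sums_unique2)
    show "(\<lambda>j. blinfun_apply (\<phi> k) (xs j)) sums blinfun_apply (\<phi> k) x"
      by (rule bounded_linear.sums[OF blinfun.bounded_linear_right xs(2)])
    have "(\<lambda>j. blinfun_apply (\<phi> k) (xs j)) =
        (\<lambda>j. if j = k then blinfun_apply (\<phi> k) (xs k) else 0)"
      using zero by auto
    then show "(\<lambda>j. blinfun_apply (\<phi> k) (xs j)) sums blinfun_apply (\<phi> k) (xs k)"
      using sums_single[of k "\<lambda>_. blinfun_apply (\<phi> k) (xs k)"] by simp
  qed
  have "blinfun_apply (\<Sum>k<n. \<phi> k) (\<Sum>j<m. xs j) =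
      (\<Sum>j<m. \<Sum>k<n. blinfun_apply (\<phi> k) (xs j))"
    by (simp add: blinfun.sum_left blinfun.sum_right)
  also have "\<dots> = (\<Sum>j<m. blinfun_apply (\<phi> j) (xs j))"
  proof (rule sum.cong)
    fix j assume "j \<in> {..<m}"
    then have "j < n" using \<open>m \<le> n\<close> by simp
    have "(\<Sum>k<n. blinfun_apply (\<phi> k) (xs j)) =
        (\<Sum>k<n. if k = j then blinfun_apply (\<phi> j) (xs j) else 0)"
      using zero by (intro sum.cong) auto
    then show "(\<Sum>k<n. blinfun_apply (\<phi> k) (xs j)) = blinfun_apply (\<phi> j) (xs j)"
      using \<open>j < n\<close> by simp
  qed simp
  finally show ?thesis
    by (simp add: blinfun.sum_left diag)
qed

lemma dual_system_partial_sums_bounded: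
  fixes smul :: "'k::{real_normed_field,euclidean_space} \<Rightarrow> 'a::banach \<Rightarrow> 'a"
  assumes "representing_system smul X"
  shows "\<exists>C\<ge>0. \<forall>\<phi> m n. (\<forall>k. \<phi> k \<in> dual_system smul X k) \<longrightarrow> m \<le> n \<longrightarrow>
    norm (\<Sum>k<m. \<phi> k) \<le> C * norm (\<Sum>k<n. \<phi> k)"
proof -
  define I where
    "I = {(\<phi>, m, n). (\<forall>k. \<phi> k \<in> dual_system smul X k) \<and> m \<le> (n :: nat)}"
  have "\<exists>C\<ge>0. \<forall>i\<in>I. norm ((\<lambda>(\<phi>, m, n). \<Sum>k<m. \<phi> k) i) \<le>
      C * (\<lambda>(\<phi>, m, n). norm (\<Sum>k<n. \<phi> k)) i"
  proof (rule uniform_boundedness_weighted)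
    fix x
    obtain xs where xs: "\<And>k. xs k \<in> X k" "xs sums x"
      using assms unfolding representing_system_def by blast
    then have "Bseq (\<lambda>n. \<Sum>k<n. xs k)"
      unfolding sums_def by (blast intro: convergentI convergent_imp_Bseq)
    then obtain B where B: "\<And>n. norm (\<Sum>k<n. xs k) \<le> B"
      unfolding Bseq_def by blast
    have "norm (blinfun_apply (\<Sum>k<m. \<phi> k) x) \<le> B * norm (\<Sum>k<n. \<phi> k)"
      if "\<And>k. \<phi> k \<in> dual_system smul X k" "m \<le> n" for \<phi> m n
    proof -
      have "norm (blinfun_apply (\<Sum>k<m. \<phi> k) x) \<le>
          norm (\<Sum>k<n. \<phi> k) * norm (\<Sum>j<m. xs j)"
        unfolding dual_system_partial_sum_apply[where n = n, OF that(1) xs that(2)]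
        by (rule norm_blinfun)
      also have "\<dots> \<le> norm (\<Sum>k<n. \<phi> k) * B"
        by (intro mult_left_mono B) simp
      finally show ?thesis
        by (simp add: mult.commute)
    qed
    then show "\<exists>B. \<forall>i\<in>I. norm (blinfun_apply ((\<lambda>(\<phi>, m, n). \<Sum>k<m. \<phi> k) i) x) \<le>
        B * (\<lambda>(\<phi>, m, n). norm (\<Sum>k<n. \<phi> k)) i"
      by (intro exI[of _ B]) (auto simp: I_def)
  qed auto
  then show ?thesis
    by (auto simp: I_def)
qed

theorem mainTheorem2:
  fixes smul :: "'k::{real_normed_field,euclidean_space} \<Rightarrow> 'a::banach \<Rightarrow> 'a"
    and X :: "nat \<Rightarrow> 'a set"
  assumes "normed_space_over smul"
    and "representing_system smul X"
  shows "schauder_decomposition dual_scale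
    (closure (module.span dual_scale (\<Union>k. dual_system smul X k)))
    (dual_system smul X)"
proof -
  obtain C where "C \<ge> 0" and C: "\<And>\<phi> m n. (\<forall>k. \<phi> k \<in> dual_system smul X k) \<Longrightarrow> m \<le> n \<Longrightarrow>
      norm (\<Sum>k<m. \<phi> k) \<le> C * norm (\<Sum>k<n. \<phi> k)"
    using dual_system_partial_sums_bounded[OF assms(2)] by blast
  show ?thesis
    by (rule schauder_decomposition_if_partial_sums_bounded
        [OF normed_space_over_dual_scale closed_subspace_dual_system \<open>C \<ge> 0\<close>])
      (simp add: C)
qed

end
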